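(* Let $n\in\mathbb{N}$ and $1\le k\le n$. Let $\alpha$ be sampled uniformly at random from the weakly increasing parking functions of length $n$, and let $|L_\alpha|$ be the number of lucky cars at the end of the parking process with preference list $\alpha$. Then $$\Pr\big[|L_\alpha|=k\big]=\frac{\frac{k}{n}\binom{2n-k-1}{n-k}}{C_n},$$ where $C_n=\frac1{n+1}\binom{2n}{n}$ is the $n$th Catalan number.
   Context: A weakly increasing parking function of length $n$ is a list $\alpha=(\alpha_1,\dots,\alpha_n)\in\{1,\dots,n\}^n$ with $\alpha_i\le i$ for all $i$ and $\alpha_1\le\cdots\le\alpha_n$. Classical parking protocol: cars $1,\dots,n$ arrive in order; car $i$ parks in spot $\alpha_i$ if it is unoccupied, otherwise in the first unoccupied spot to the right of $\alpha_i$. A car is lucky if it parks in its preferred spot $\alpha_i$. *)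

theory Defs
  imports "HOL-Probability.Probability_Mass_Function"
begin

text \<open>
  A preference list \<open>\<alpha> = (\<alpha>\<^sub>1, \<dots>, \<alpha>\<^sub>n)\<close> is a list of naturals. Spots are numbered from 1, while
  list positions are numbered from 0: the preference of the \<open>(i+1)\<close>-st car is \<open>\<alpha> ! i\<close>, so
  \<open>\<alpha>\<^sub>i \<le> i\<close> becomes \<open>\<alpha> ! i \<le> i + 1\<close>.
\<close>

definition weakly_increasing_pfs :: "nat \<Rightarrow> nat list set" where
  "weakly_increasing_pfs n =
     {\<alpha>. length \<alpha> = n \<and> set \<alpha> \<subseteq> {1..n} \<and> (\<forall>i<n. \<alpha> ! i \<le> i + 1) \<and> sorted \<alpha>}"

text \<open>
  The street is not truncated after spot \<open>n\<close>, so the spot is defined for every finite \<open>occ\<close>. For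
  parking functions of length \<open>n\<close> all cars park in \<open>{1..n}\<close> and the truncation makes no difference.
\<close>

definition parking_spot :: "nat set \<Rightarrow> nat \<Rightarrow> nat" where
  "parking_spot occ a = (if a \<notin> occ then a else (LEAST s. a < s \<and> s \<notin> occ))"

primrec park_from :: "nat set \<Rightarrow> nat list \<Rightarrow> nat list" where
  "park_from occ [] = []"
| "park_from occ (a # \<alpha>) =
     parking_spot occ a # park_from (insert (parking_spot occ a) occ) \<alpha>"

definition parking_outcome :: "nat list \<Rightarrow> nat list" where
  "parking_outcome \<alpha> = park_from {} \<alpha>"

definition lucky_cars :: "nat list \<Rightarrow> nat set" where
  "lucky_cars \<alpha> = {i. i < length \<alpha> \<and> parking_outcome \<alpha> ! i = \<alpha> ! i}"

definition catalan :: "nat \<Rightarrow> real" where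
  "catalan n = 1 / real (n + 1) * real ((2 * n) choose n)"

text \<open>The next two facts make \<open>pmf_of_set (weakly_increasing_pfs n)\<close> the uniform distribution.\<close>

lemma finite_weakly_increasing_pfs: "finite (weakly_increasing_pfs n)"
proof (rule finite_subset)
  show "weakly_increasing_pfs n \<subseteq> {\<alpha>. set \<alpha> \<subseteq> {1..n} \<and> length \<alpha> = n}"
    by (auto simp: weakly_increasing_pfs_def)
qed (simp add: finite_lists_length_eq)

lemma weakly_increasing_pfs_nonempty: "weakly_increasing_pfs n \<noteq> {}"
proof -
  have "replicate n 1 \<in> weakly_increasing_pfs n"
    by (auto simp: weakly_increasing_pfs_def)
  then show ?thesis by blast
qed

end

theory Submission
  imports Defs
begin

text \<open>
  In a weakly increasing parking function car \<open>i\<close> always ends up in spot \<open>i\<close>: when it arrives,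
  exactly the spots \<open>1, \<dots>, i - 1\<close> are taken, and its preference is at most \<open>i\<close>. So the lucky cars
  are the fixed points \<open>\<alpha>\<^sub>i = i\<close>, and the probability is a quotient of two counts.

  To count by fixed points, bound the largest entry by \<open>m\<close>. Splitting on whether the last entry
  equals \<open>m\<close> gives a Pascal-type recursion in the length and in \<open>m\<close>; the last entry is a fixed
  point only on the diagonal, where \<open>m\<close> is the length. A difference of two neighbouring binomial
  coefficients, as in the ballot problem, obeys both the diagonal and the off-diagonal form of this
  recursion (\<open>card_bounded_pfs\<close>). On the diagonal it simplifies to
  \<open>k/n \<cdot> (2n - k - 1 choose n - k)\<close> (\<open>card_pfs_lucky\<close>).

  The total needs no separate count. Putting a car with preference 1 in front delays all other cars
  by one place, which destroys all fixed points and creates one at the front. Hence the weakly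
  increasing parking functions of length \<open>n\<close> are in bijection with those of length \<open>n + 1\<close> that have
  exactly one lucky car, and the same formula yields the Catalan number
  (\<open>card_weakly_increasing_pfs\<close>).
\<close>

section \<open>Lucky cars are fixed points\<close>

lemma parking_spot_initial_segment:
  assumes "1 \<le> a" "a \<le> m + 1"
  shows "parking_spot {1..m} a = m + 1"
proof (cases "a = m + 1")
  case True
  then show ?thesis by (simp add: parking_spot_def)
next
  case False
  have "(LEAST s. a < s \<and> s \<notin> {1..m}) = m + 1"
    by (rule Least_equality) (use assms False in auto)
  then show ?thesis using assms False by (simp add: parking_spot_def)
qed

text \<open>
  Every car fills the first free spot, so the occupied spots stay an initial segment and the
  induction goes through with \<open>m\<close> cars already parked.
\<close>

lemma park_from_initial_segment:
  assumes "\<And>i. i < length \<alpha> \<Longrightarrow> 1 \<le> \<alpha> ! i \<and> \<alpha> ! i \<le> m + i + 1"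
  shows "park_from {1..m} \<alpha> = [m + 1..<m + 1 + length \<alpha>]"
  using assms
proof (induction \<alpha> arbitrary: m)
  case Nil
  then show ?case by simp
next
  case (Cons a \<alpha>)
  have spot: "parking_spot {1..m} a = m + 1"
    using Cons.prems[of 0] by (intro parking_spot_initial_segment) auto
  have "park_from {1..m + 1} \<alpha> = [m + 2..<m + 2 + length \<alpha>]"
  proof -
    have "1 \<le> \<alpha> ! i \<and> \<alpha> ! i \<le> (m + 1) + i + 1" if "i < length \<alpha>" for i
      using Cons.prems[of "Suc i"] that by simp
    from Cons.IH[OF this] show ?thesis by simp
  qed
  moreover have "insert (m + 1) {1..m} = {1..m + 1}" by auto
  ultimately show ?case
    using spot by (simp add: upt_conv_Cons del: upt_Suc)
qed

lemma lucky_cars_eq_fixed_points: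
  assumes "\<alpha> \<in> weakly_increasing_pfs n"
  shows "lucky_cars \<alpha> = {i. i < n \<and> \<alpha> ! i = i + 1}"
proof -
  have len: "length \<alpha> = n" and bound: "\<And>i. i < n \<Longrightarrow> \<alpha> ! i \<le> i + 1"
    using assms by (auto simp: weakly_increasing_pfs_def)
  have pos: "1 \<le> \<alpha> ! i" if "i < n" for i
  proof -
    have "\<alpha> ! i \<in> set \<alpha>" using that len by simp
    then show ?thesis using assms by (auto simp: weakly_increasing_pfs_def)
  qed
  have "parking_outcome \<alpha> = [1..<1 + n]"
    using park_from_initial_segment[of \<alpha> 0] len bound pos by (simp add: parking_outcome_def)
  then have "parking_outcome \<alpha> ! i = i + 1" if "i < n" for i
    using that by (simp del: upt_Suc)
  then show ?thesis using len by (auto simp: lucky_cars_def)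
qed

lemma pfs_snoc_iff:
  "\<alpha> @ [x] \<in> weakly_increasing_pfs (Suc n) \<longleftrightarrow>
     \<alpha> \<in> weakly_increasing_pfs n \<and> 1 \<le> x \<and> x \<le> Suc n \<and> (\<forall>y\<in>set \<alpha>. y \<le> x)"
  (is "?L \<longleftrightarrow> ?R")
proof
  assume L: ?L
  then have len: "length \<alpha> = n" by (simp add: weakly_increasing_pfs_def)
  have bound: "\<alpha> ! i \<le> i + 1" if "i < n" for i
  proof -
    have "(\<alpha> @ [x]) ! i \<le> i + 1" using L that by (simp add: weakly_increasing_pfs_def)
    then show ?thesis using that len by (simp add: nth_append)
  qed
  have "set \<alpha> \<subseteq> {1..n}"
  proof
    fix y assume y: "y \<in> set \<alpha>"
    then obtain i where "i < n" "y = \<alpha> ! i" using len by (metis in_set_conv_nth)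
    then have "y \<le> n" using bound[of i] by simp
    moreover have "1 \<le> y" using y L by (auto simp: weakly_increasing_pfs_def)
    ultimately show "y \<in> {1..n}" by simp
  qed
  then show ?R
    using L len bound by (auto simp: weakly_increasing_pfs_def sorted_append)
next
  assume ?R
  then show ?L
    by (auto simp: weakly_increasing_pfs_def sorted_append nth_append less_Suc_eq)
qed

lemma card_lucky_cars_snoc:
  assumes "\<alpha> @ [x] \<in> weakly_increasing_pfs (Suc n)"
  shows "card (lucky_cars (\<alpha> @ [x])) = card (lucky_cars \<alpha>) + (if x = Suc n then 1 else 0)"
proof -
  have \<alpha>: "\<alpha> \<in> weakly_increasing_pfs n" using assms pfs_snoc_iff by blast
  then have len: "length \<alpha> = n" by (simp add: weakly_increasing_pfs_def)
  have "{i. i < Suc n \<and> (\<alpha> @ [x]) ! i = i + 1}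
      = {i. i < n \<and> \<alpha> ! i = i + 1} \<union> (if x = Suc n then {n} else {})"
    using len by (auto simp: nth_append less_Suc_eq)
  then show ?thesis
    by (simp add: lucky_cars_eq_fixed_points[OF assms] lucky_cars_eq_fixed_points[OF \<alpha>])
qed

section \<open>Counting by the number of lucky cars\<close>

definition bounded_pfs :: "nat \<Rightarrow> nat \<Rightarrow> nat \<Rightarrow> nat list set" where
  "bounded_pfs n m k =
     {\<alpha> \<in> weakly_increasing_pfs n. set \<alpha> \<subseteq> {..m} \<and> card (lucky_cars \<alpha>) = k}"

lemma finite_bounded_pfs: "finite (bounded_pfs n m k)"
  by (rule finite_subset[OF _ finite_weakly_increasing_pfs[of n]]) (auto simp: bounded_pfs_def)

lemma bounded_pfs_eq_if_bound_large:
  assumes "n \<le> m"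
  shows "bounded_pfs n m k = {\<alpha> \<in> weakly_increasing_pfs n. card (lucky_cars \<alpha>) = k}"
  using assms by (fastforce simp: bounded_pfs_def weakly_increasing_pfs_def)

text \<open>A fixed point \<open>\<alpha>\<^sub>i = i\<close> has \<open>i \<le> m\<close>, so there are at most \<open>m\<close> of them.\<close>

lemma bounded_pfs_empty_if_too_lucky:
  assumes "m < k"
  shows "bounded_pfs n m k = {}"
proof -
  have "card (lucky_cars \<alpha>) \<le> m"
    if \<alpha>: "\<alpha> \<in> weakly_increasing_pfs n" and bound: "set \<alpha> \<subseteq> {..m}" for \<alpha>
  proof -
    have len: "length \<alpha> = n" using \<alpha> by (simp add: weakly_increasing_pfs_def)
    have "lucky_cars \<alpha> \<subseteq> {..<m}"
    proof
      fix i assume "i \<in> lucky_cars \<alpha>"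
      then have i: "i < n" "\<alpha> ! i = i + 1" using lucky_cars_eq_fixed_points[OF \<alpha>] by auto
      then have "i + 1 \<in> set \<alpha>" using len by (metis nth_mem)
      then show "i \<in> {..<m}" using bound by auto
    qed
    then show ?thesis using card_mono[of "{..<m}"] by fastforce
  qed
  then show ?thesis using assms by (fastforce simp: bounded_pfs_def)
qed

text \<open>The first car is always lucky.\<close>

lemma bounded_pfs_no_lucky_empty: "bounded_pfs (Suc n) m 0 = {}"
proof -
  have "card (lucky_cars \<alpha>) \<noteq> 0" if \<alpha>: "\<alpha> \<in> weakly_increasing_pfs (Suc n)" for \<alpha>
  proof -
    have "\<alpha> ! 0 \<in> set \<alpha>" "\<alpha> ! 0 \<le> 1" "set \<alpha> \<subseteq> {1..Suc n}"
      using \<alpha> by (auto simp: weakly_increasing_pfs_def)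
    then have "\<alpha> ! 0 = 1" by fastforce
    then have "0 \<in> lucky_cars \<alpha>" using lucky_cars_eq_fixed_points[OF \<alpha>] by simp
    moreover have "finite (lucky_cars \<alpha>)" by (simp add: lucky_cars_def)
    ultimately show ?thesis by auto
  qed
  then show ?thesis by (auto simp: bounded_pfs_def)
qed

text \<open>
  Either all entries are at most \<open>m\<close>, or the last entry is \<open>m + 1\<close>. Removing this last entry loses
  a fixed point exactly when \<open>m = n\<close>.
\<close>

lemma card_bounded_pfs_rec:
  assumes "m \<le> n"
  shows "card (bounded_pfs (Suc n) (Suc m) (Suc j))
       = card (bounded_pfs (Suc n) m (Suc j))
         + card (bounded_pfs n (Suc m) (if m = n then j else Suc j))"
proof -
  define B where "B = bounded_pfs n (Suc m) (if m = n then j else Suc j)"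
  have snoc: "\<alpha> @ [Suc m] \<in> bounded_pfs (Suc n) (Suc m) (Suc j) \<longleftrightarrow> \<alpha> \<in> B" for \<alpha>
  proof -
    have "\<alpha> @ [Suc m] \<in> weakly_increasing_pfs (Suc n) \<longleftrightarrow>
        \<alpha> \<in> weakly_increasing_pfs n \<and> set \<alpha> \<subseteq> {..Suc m}"
      using assms by (auto simp: pfs_snoc_iff)
    then show ?thesis
      using card_lucky_cars_snoc[of \<alpha> "Suc m" n] by (auto simp: B_def bounded_pfs_def)
  qed
  have "bounded_pfs (Suc n) (Suc m) (Suc j)
      = bounded_pfs (Suc n) m (Suc j) \<union> (\<lambda>\<alpha>. \<alpha> @ [Suc m]) ` B" (is "?L = ?R")
  proof
    have "bounded_pfs (Suc n) m (Suc j) \<subseteq> ?L" by (fastforce simp: bounded_pfs_def)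
    then show "?R \<subseteq> ?L" using snoc by blast
    show "?L \<subseteq> ?R"
    proof
      fix \<beta> assume \<beta>: "\<beta> \<in> ?L"
      then have "length \<beta> = Suc n" by (simp add: bounded_pfs_def weakly_increasing_pfs_def)
      then obtain \<alpha> x where \<beta>_eq: "\<beta> = \<alpha> @ [x]" by (metis length_Suc_conv_rev)
      have last_max: "\<forall>y\<in>set \<alpha>. y \<le> x" and "x \<le> Suc m"
        using \<beta> \<beta>_eq pfs_snoc_iff by (auto simp: bounded_pfs_def)
      show "\<beta> \<in> ?R"
      proof (cases "x = Suc m")
        case True
        then show ?thesis using \<beta> \<beta>_eq snoc by auto
      next
        case False
        with \<open>x \<le> Suc m\<close> have "x \<le> m" by simp
        with last_max \<beta>_eq have "set \<beta> \<subseteq> {..m}" by auto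
        then show ?thesis using \<beta> by (auto simp: bounded_pfs_def)
      qed
    qed
  qed
  moreover have "bounded_pfs (Suc n) m (Suc j) \<inter> (\<lambda>\<alpha>. \<alpha> @ [Suc m]) ` B = {}"
    by (auto simp: bounded_pfs_def)
  moreover have "card ((\<lambda>\<alpha>. \<alpha> @ [Suc m]) ` B) = card B"
    by (rule card_image) (auto simp: inj_on_def)
  moreover have "finite B" by (simp add: B_def finite_bounded_pfs)
  ultimately show ?thesis
    by (simp add: card_Un_disjoint finite_bounded_pfs B_def)
qed

text \<open>
  Both sides satisfy the same recursion: decreasing \<open>m\<close>, decreasing \<open>n\<close> off the diagonal, and
  decreasing \<open>n\<close>, \<open>m\<close> and \<open>j\<close> together on the diagonal each lower the upper index \<open>n + m - j\<close> by
  one, so every step is Pascal's rule. The binomial difference also vanishes where the count does: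
  at \<open>m + 1 = j\<close>, and at \<open>j = -1\<close> on the diagonal by symmetry.
\<close>

lemma card_bounded_pfs:
  assumes "j \<le> m" "m \<le> n"
  shows "card (bounded_pfs (Suc n) (Suc m) (Suc j)) + ((n + m - j) choose Suc n)
       = (n + m - j) choose n"
  using assms
proof (induction n arbitrary: m j)
  case 0
  have "bounded_pfs 0 (Suc 0) 0 = {[]}"
    by (auto simp: bounded_pfs_def weakly_increasing_pfs_def lucky_cars_def)
  then show ?case
    using 0 card_bounded_pfs_rec[of 0 0 0] by (simp add: bounded_pfs_empty_if_too_lucky)
next
  case (Suc n)
  note IH_n = Suc.IH
  from Suc.prems show ?case
  proof (induction m)
    case 0
    then show ?case
      using card_bounded_pfs_rec[of 0 "Suc n" 0] IH_n[of 0 0]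
      by (simp add: bounded_pfs_empty_if_too_lucky binomial_eq_0)
  next
    case (Suc m)
    define N where "N = Suc n + m - j"
    have N: "Suc n + Suc m - j = Suc N" using Suc.prems by (simp add: N_def)
    have smaller_bound:
      "card (bounded_pfs (Suc (Suc n)) (Suc m) (Suc j)) + (N choose Suc (Suc n)) = N choose Suc n"
    proof (cases "j \<le> m")
      case True
      then show ?thesis using Suc.IH Suc.prems by (simp add: N_def)
    next
      case False
      then have "N = n" using Suc.prems by (simp add: N_def)
      then show ?thesis using False by (simp add: bounded_pfs_empty_if_too_lucky binomial_eq_0)
    qed
    have shorter:
      "card (bounded_pfs (Suc n) (Suc (Suc m)) (if m = n then j else Suc j)) + (N choose Suc n)
         = N choose n"
    proof (cases "m = n")
      case False
      then show ?thesis using IH_n[of j "Suc m"] Suc.prems by (simp add: N_def)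
    next
      case True
      have same: "bounded_pfs (Suc n) (Suc (Suc n)) j = bounded_pfs (Suc n) (Suc n) j"
        by (simp add: bounded_pfs_eq_if_bound_large)
      show ?thesis
      proof (cases j)
        case 0
        have "N choose Suc n = N choose n"
          using binomial_symmetric[of n N] True 0 by (simp add: N_def)
        then show ?thesis using True 0 by (simp add: bounded_pfs_no_lucky_empty)
      next
        case (Suc i)
        then show ?thesis using IH_n[of i n] Suc.prems True same by (simp add: N_def)
      qed
    qed
    show ?case
      using card_bounded_pfs_rec[of "Suc m" "Suc n" j] smaller_bound shorter Suc.prems
      unfolding N by simp
  qed
qed

lemma card_pfs_lucky:
  assumes "j \<le> n"
  shows "real (card {\<alpha> \<in> weakly_increasing_pfs (Suc n). card (lucky_cars \<alpha>) = Suc j})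
       = real (Suc j) / real (Suc n) * real ((2 * n - j) choose n)"
proof -
  define M where "M = 2 * n - j"
  have M: "M - n = n - j" using assms by (simp add: M_def)
  have "card {\<alpha> \<in> weakly_increasing_pfs (Suc n). card (lucky_cars \<alpha>) = Suc j}
      + (M choose Suc n) = M choose n"
    using card_bounded_pfs[of j n n] assms
    by (simp add: M_def mult_2 bounded_pfs_eq_if_bound_large)
  then have diff: "real (card {\<alpha> \<in> weakly_increasing_pfs (Suc n). card (lucky_cars \<alpha>) = Suc j})
      = real (M choose n) - real (M choose Suc n)"
    by linarith
  have "real (Suc n) * real (M choose Suc n) = (real n - real j) * real (M choose n)"
  proof -
    have "Suc n * (M choose Suc n) = (n - j) * (M choose n)"
      using binomial_absorb_comp[of M n] binomial_absorption[of n M] M by simp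
    then have "real (Suc n * (M choose Suc n)) = real ((n - j) * (M choose n))" by simp
    then show ?thesis using assms by (simp only: of_nat_mult of_nat_diff)
  qed
  then have "real (Suc n) * (real (M choose n) - real (M choose Suc n))
      = real (Suc j) * real (M choose n)"
    by (simp add: algebra_simps)
  then show ?thesis
    unfolding diff by (simp add: M_def nonzero_eq_divide_eq mult.commute)
qed

section \<open>The total count\<close>

text \<open>
  As the second to last cars of \<open>1 # \<alpha>\<close>, the entries of \<open>\<alpha>\<close> only have to satisfy
  \<open>\<alpha>\<^sub>i \<le> i + 1\<close>. That none of these cars is lucky excludes equality, which leaves
  \<open>\<alpha>\<^sub>i \<le> i\<close>.
\<close>

lemma pfs_Cons_1_iff:
  "1 # \<alpha> \<in> weakly_increasing_pfs (Suc n) \<and> card (lucky_cars (1 # \<alpha>)) = 1 \<longleftrightarrow>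
     \<alpha> \<in> weakly_increasing_pfs n" (is "?L \<longleftrightarrow> ?R")
proof
  assume L: ?L
  then have pf: "1 # \<alpha> \<in> weakly_increasing_pfs (Suc n)" by simp
  then have len: "length \<alpha> = n" by (simp add: weakly_increasing_pfs_def)
  have "0 \<in> lucky_cars (1 # \<alpha>)" using lucky_cars_eq_fixed_points[OF pf] by simp
  moreover obtain c where "lucky_cars (1 # \<alpha>) = {c}" using L card_1_singletonE by blast
  ultimately have only: "lucky_cars (1 # \<alpha>) = {0}" by simp
  have bound: "\<alpha> ! i \<le> i + 1" if "i < n" for i
  proof -
    have "(1 # \<alpha>) ! Suc i \<le> Suc i + 1"
      using pf that unfolding weakly_increasing_pfs_def by blast
    moreover have "Suc i \<notin> lucky_cars (1 # \<alpha>)" using only by simp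
    ultimately show ?thesis using that lucky_cars_eq_fixed_points[OF pf] by auto
  qed
  have "set \<alpha> \<subseteq> {1..n}"
  proof
    fix y assume y: "y \<in> set \<alpha>"
    then obtain i where "i < n" "y = \<alpha> ! i" using len by (metis in_set_conv_nth)
    then have "y \<le> n" using bound[of i] by simp
    moreover have "1 \<le> y" using y pf by (auto simp: weakly_increasing_pfs_def)
    ultimately show "y \<in> {1..n}" by simp
  qed
  then show ?R using pf len bound by (simp add: weakly_increasing_pfs_def)
next
  assume R: ?R
  then have bound: "\<And>i. i < n \<Longrightarrow> \<alpha> ! i \<le> i + 1" by (simp add: weakly_increasing_pfs_def)
  have pf: "1 # \<alpha> \<in> weakly_increasing_pfs (Suc n)"
    using R by (fastforce simp: weakly_increasing_pfs_def nth_Cons split: nat.splits)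
  have "lucky_cars (1 # \<alpha>) = {0}"
    using bound unfolding lucky_cars_eq_fixed_points[OF pf]
    by (fastforce simp: nth_Cons split: nat.splits)
  then show ?L using pf by simp
qed

lemma card_weakly_increasing_pfs: "real (card (weakly_increasing_pfs n)) = catalan n"
proof -
  have "{\<alpha> \<in> weakly_increasing_pfs (Suc n). card (lucky_cars \<alpha>) = 1}
      = (#) 1 ` weakly_increasing_pfs n" (is "?S = _")
  proof
    show "(#) 1 ` weakly_increasing_pfs n \<subseteq> ?S" using pfs_Cons_1_iff by blast
    show "?S \<subseteq> (#) 1 ` weakly_increasing_pfs n"
    proof
      fix \<beta> assume \<beta>: "\<beta> \<in> ?S"
      then obtain x \<alpha> where eq: "\<beta> = x # \<alpha>"
        by (auto simp: weakly_increasing_pfs_def length_Suc_conv)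
      have "x = 1" using \<beta> unfolding eq weakly_increasing_pfs_def by fastforce
      then show "\<beta> \<in> (#) 1 ` weakly_increasing_pfs n" using \<beta> eq pfs_Cons_1_iff by blast
    qed
  qed
  then have "card ?S = card (weakly_increasing_pfs n)" by (simp add: card_image)
  then show ?thesis using card_pfs_lucky[of 0 n] by (simp add: catalan_def)
qed

theorem lemma2p11:
  fixes n k :: nat
  assumes "1 \<le> k" and "k \<le> n"
  shows "measure_pmf.prob (pmf_of_set (weakly_increasing_pfs n)) {\<alpha>. card (lucky_cars \<alpha>) = k}
       = (real k / real n * real ((2 * n - k - 1) choose (n - k))) / catalan n"
proof -
  obtain j where k: "k = Suc j" using assms by (cases k) auto
  obtain N where n: "n = Suc N" using assms by (cases n) auto
  have "j \<le> N" using assms k n by simp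
  have "(2 * n - k - 1) choose (n - k) = (2 * N - j) choose N"
    using binomial_symmetric[of N "2 * N - j"] \<open>j \<le> N\<close> by (simp add: k n)
  then have "real (card {\<alpha> \<in> weakly_increasing_pfs n. card (lucky_cars \<alpha>) = k})
      = real k / real n * real ((2 * n - k - 1) choose (n - k))"
    using card_pfs_lucky[OF \<open>j \<le> N\<close>] by (simp only: k n)
  moreover have "weakly_increasing_pfs n \<inter> {\<alpha>. card (lucky_cars \<alpha>) = k}
      = {\<alpha> \<in> weakly_increasing_pfs n. card (lucky_cars \<alpha>) = k}"
    by auto
  ultimately show ?thesis
    by (simp add: measure_pmf_of_set weakly_increasing_pfs_nonempty finite_weakly_increasing_pfs
        card_weakly_increasing_pfs)
qed

end
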